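(* Let $f:\mathbb{R}^n\to\mathbb{R}\cup\{\infty\}$ be a lower semicontinuous gauge function. For $r>0$ define $g_r(x)=[e_r(f^2)](x)$ and $h_r=\sqrt{g_r}$. Then for every $r>0$, $h_r$ is a gauge function and $h_r$ is differentiable at every point of $\mathbb{R}^n$ outside $\{x: f(x)=0\}$; moreover $\lim_{r\nearrow\infty}h_r(x)=f(x)$ for all $x\in\mathbb{R}^n$.
   Context: A function $k$ on $\mathbb{R}^n$ (values in $\mathbb{R}\cup\{\infty\}$) is a gauge if it is nonnegative, positively homogeneous ($k(\lambda x)=\lambda k(x)$ for all $\lambda>0$), convex, and $k(0)=0$. Here $\mathbb{R}^n$ carries the Euclidean norm $\|\cdot\|$, and for a proper lower semicontinuous $\varphi:\mathbb{R}^n\to\mathbb{R}\cup\{\infty\}$ and $r>0$, the Moreau envelope is $e_r\varphi(x)=\inf_{y\in\mathbb{R}^n}\{\varphi(y)+\frac r2\|y-x\|^2\}$. The square is $f^2(x)=(f(x))^2$, with $f^2(x)=\infty$ where $f(x)=\infty$. *)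

theory Defs
  imports "HOL-Analysis.Analysis"
begin

text \<open>Functions with values in \<open>\<real> \<union> {\<infinity>}\<close> are \<^typ>\<open>ereal\<close>-valued functions that never
  take the value \<open>-\<infinity>\<close>.\<close>

text \<open>Convexity is only meaningful for functions avoiding \<open>-\<infinity>\<close>. At the endpoints
  \<open>u = 0\<close> and \<open>v = 0\<close> the convention \<open>0 * \<infinity> = 0\<close> makes the inequality trivial.\<close>

definition ereal_convex :: "('a::real_vector \<Rightarrow> ereal) \<Rightarrow> bool" where
  "ereal_convex f \<longleftrightarrow>
    (\<forall>x y. \<forall>u\<ge>0. \<forall>v\<ge>0. u + v = 1 \<longrightarrow>
      f (u *\<^sub>R x + v *\<^sub>R y) \<le> ereal u * f x + ereal v * f y)"

text \<open>The name \<open>gauge\<close> is taken by Henstock-Kurzweil integration.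
  Nonnegativity excludes the value \<open>-\<infinity>\<close>.\<close>

definition gauge_function :: "('a::real_vector \<Rightarrow> ereal) \<Rightarrow> bool" where
  "gauge_function k \<longleftrightarrow>
    (\<forall>x. 0 \<le> k x) \<and>
    (\<forall>c>0. \<forall>x. k (c *\<^sub>R x) = ereal c * k x) \<and>
    ereal_convex k \<and>
    k 0 = 0"

definition lower_semicontinuous :: "('a::topological_space \<Rightarrow> ereal) \<Rightarrow> bool" where
  "lower_semicontinuous f \<longleftrightarrow> (\<forall>x. f x \<le> Liminf (nhds x) f)"

definition moreau_envelope ::
    "real \<Rightarrow> ('a::real_normed_vector \<Rightarrow> ereal) \<Rightarrow> 'a \<Rightarrow> ereal" where
  "moreau_envelope r \<phi> x = (INF y. \<phi> y + ereal (r / 2 * (norm (y - x))\<^sup>2))"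

text \<open>Only the values on \<open>[0, \<infinity>]\<close> matter; on negative arguments it follows the odd
  extension used by \<^const>\<open>sqrt\<close>.\<close>

fun ereal_sqrt :: "ereal \<Rightarrow> ereal" where
  "ereal_sqrt (ereal a) = ereal (sqrt a)"
| "ereal_sqrt PInfty = PInfty"
| "ereal_sqrt MInfty = MInfty"

text \<open>Differentiability at a point includes finiteness on a neighbourhood of it, since
  \<^const>\<open>real_of_ereal\<close> would silently map infinite values to \<open>0\<close>.\<close>

definition ereal_differentiable_at ::
    "('a::real_normed_vector \<Rightarrow> ereal) \<Rightarrow> 'a \<Rightarrow> bool" where
  "ereal_differentiable_at f x \<longleftrightarrow>
    (\<forall>\<^sub>F y in nhds x. \<bar>f y\<bar> \<noteq> \<infinity>) \<and> (\<lambda>y. real_of_ereal (f y)) differentiable (at x)"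

end

theory Submission
  imports Defs
begin

text \<open>
  Lower semicontinuity and coercivity give, for every \<open>x\<close>, a minimizer \<open>p\<close> in the definition of
  the envelope, so that \<open>h\<^sub>r(x)\<close> is the Euclidean norm of the pair \<open>(f(p), sqrt(r/2) |p - x|)\<close>.
  Homogeneity of \<open>f\<close> and of the norm, and Minkowski's inequality in the plane, make \<open>h\<^sub>r\<close> a gauge.
  Keeping \<open>p\<close> fixed and varying \<open>x\<close> yields a majorant of \<open>h\<^sub>r\<close> that touches it at \<open>x\<close> and is smooth
  there when \<open>h\<^sub>r(x) > 0\<close>, that is, when \<open>f(x) \<noteq> 0\<close>; a convex function touched from above by a
  differentiable one is differentiable at the contact point. Finally, if \<open>f > a\<close> on the ball of
  radius \<open>\<delta>\<close> about \<open>x\<close>, then \<open>min a (sqrt(r/2) \<delta>) \<le> h\<^sub>r(x) \<le> f(x)\<close>.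
\<close>

section \<open>Lower semicontinuous functions\<close>

lemma lower_semicontinuous_iff:
  "lower_semicontinuous f \<longleftrightarrow> (\<forall>x. \<forall>a<f x. eventually (\<lambda>y. a < f y) (nhds x))"
  by (simp add: lower_semicontinuous_def le_Liminf_iff)

text \<open>Without a minimizer, the open superlevel sets \<open>U y\<close> with \<open>y\<close>
  in \<open>K\<close> cover \<open>K\<close>. In a finite subcover, the index with the least value
  lies in no set of the subcover.\<close>

lemma lower_semicontinuous_attains_inf:
  assumes "lower_semicontinuous \<phi>" "compact K" "K \<noteq> {}"
  obtains p where "p \<in> K" "\<And>y. y \<in> K \<Longrightarrow> \<phi> p \<le> \<phi> y"
proof (rule ccontr)
  assume "\<not> thesis"
  with that have *: "\<forall>p\<in>K. \<exists>y\<in>K. \<phi> y < \<phi> p" by (meson not_le)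
  define U where "U y = {p. \<phi> y < \<phi> p}" for y
  have "open (U y)" for y
  proof (subst open_subopen, intro ballI)
    fix p assume "p \<in> U y"
    with assms(1) have "eventually (\<lambda>q. \<phi> y < \<phi> q) (nhds p)"
      by (simp add: lower_semicontinuous_iff U_def)
    then show "\<exists>T. open T \<and> p \<in> T \<and> T \<subseteq> U y" by (auto simp: eventually_nhds U_def)
  qed
  moreover have "K \<subseteq> (\<Union>y\<in>K. U y)" using * by (auto simp: U_def)
  ultimately obtain C where C: "C \<subseteq> K" "finite C" "K \<subseteq> (\<Union>y\<in>C. U y)"
    using compactE_image[OF assms(2), of K U] by metis
  have "C \<noteq> {}" using C(3) assms(3) by auto
  then obtain y where y: "y \<in> C" "\<forall>z\<in>C. \<phi> y \<le> \<phi> z"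
    using C(2) by (metis arg_min_if_finite(1) arg_min_least)
  with C obtain z where "z \<in> C" "\<phi> z < \<phi> y" by (auto simp: U_def)
  with y show False by (meson not_le)
qed

text \<open>Turns strict superlevel sets of a square into those of the function itself, which is how
  lower semicontinuity passes from \<open>f\<close> to its square.\<close>

lemma ereal_less_power2_iff:
  fixes z :: ereal
  assumes "0 \<le> a" "0 \<le> z"
  shows "ereal a < z\<^sup>2 \<longleftrightarrow> ereal (sqrt a) < z"
proof (cases z)
  case (real t)
  then show ?thesis using assms real_less_rsqrt real_sqrt_less_iff[of a "t\<^sup>2"]
    by (auto simp: power2_eq_square)
qed (use assms in \<open>auto simp: power2_eq_square\<close>)

lemma lower_semicontinuous_power2:
  fixes f :: "'a::topological_space \<Rightarrow> ereal"
  assumes "lower_semicontinuous f" "\<And>x. 0 \<le> f x"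
  shows "lower_semicontinuous (\<lambda>x. (f x)\<^sup>2)"
  unfolding lower_semicontinuous_iff
proof (intro allI impI)
  fix x and a :: ereal assume a: "a < (f x)\<^sup>2"
  show "eventually (\<lambda>y. a < (f y)\<^sup>2) (nhds x)"
  proof (cases "0 \<le> a")
    case True
    with a obtain b where b: "a = ereal b" "0 \<le> b" by (cases a) auto
    with a assms show ?thesis
      unfolding lower_semicontinuous_iff by (simp add: ereal_less_power2_iff)
  next
    case False
    have "0 \<le> (f y)\<^sup>2" for y using assms(2) by (simp add: power2_eq_square)
    then show ?thesis using False by (metis (no_types, lifting) always_eventually less_le_trans not_le)
  qed
qed

lemma lower_semicontinuous_add:
  fixes f g :: "'a::topological_space \<Rightarrow> ereal"
  assumes "lower_semicontinuous f" "lower_semicontinuous g" "\<And>x. 0 \<le> f x" "\<And>x. 0 \<le> g x"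
  shows "lower_semicontinuous (\<lambda>x. f x + g x)"
  unfolding lower_semicontinuous_def
proof
  fix x
  have "f x + g x \<le> Liminf (nhds x) f + Liminf (nhds x) g"
    using assms(1,2) by (intro add_mono) (auto simp: lower_semicontinuous_def)
  also have "\<dots> \<le> Liminf (nhds x) (\<lambda>y. f y + g y)"
    using assms(3,4) by (intro Liminf_add_le) auto
  finally show "f x + g x \<le> Liminf (nhds x) (\<lambda>y. f y + g y)" .
qed

lemma lower_semicontinuous_continuous:
  assumes "continuous_on UNIV q"
  shows "lower_semicontinuous (\<lambda>x. ereal (q x))"
  unfolding lower_semicontinuous_iff
proof (intro allI impI)
  fix x c assume c: "c < ereal (q x)"
  have "((\<lambda>y. ereal (q y)) \<longlongrightarrow> ereal (q x)) (nhds x)"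
    using continuous_on_tendsto_compose[OF assms tendsto_ident_at, of x UNIV]
    by (simp add: tendsto_nhds_iff)
  then show "\<forall>\<^sub>F y in nhds x. c < ereal (q y)" using c by (rule order_tendstoD)
qed

section \<open>Convex functions with a differentiable majorant\<close>

text \<open>The majorant bounds the increment of \<open>H\<close> only from above. Reflecting
  \<open>y\<close> in \<open>x\<close> to \<open>z = 2x - y\<close>, convexity gives
  \<open>H y - H x >= H x - H z >= S x - S z\<close>, and linearity of the derivative of
  \<open>S\<close> turns this into the missing lower bound.\<close>

lemma differentiable_if_convex_touching_majorant:
  fixes H S :: "'a::real_normed_vector \<Rightarrow> real"
  assumes conv: "convex_on UNIV H" and S: "S differentiable (at x)"
    and le: "\<And>y. H y \<le> S y" and eq: "H x = S x"
  shows "H differentiable (at x)"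
proof -
  from S obtain L where L: "(S has_derivative L) (at x)" by (auto simp: differentiable_def)
  then have bl: "bounded_linear L" by (rule has_derivative_bounded_linear)
  have "(H has_derivative L) (at x)"
    unfolding has_derivative_at_alt
  proof (intro conjI allI impI bl)
    fix e :: real assume "e > 0"
    with L obtain d where d: "d > 0"
      "\<And>y. norm (y - x) < d \<Longrightarrow> \<bar>S y - S x - L (y - x)\<bar> \<le> e * norm (y - x)"
      unfolding has_derivative_at_alt by auto
    have "\<bar>H y - H x - L (y - x)\<bar> \<le> e * norm (y - x)" if y: "norm (y - x) < d" for y
    proof -
      let ?z = "2 *\<^sub>R x - y"
      have z: "?z - x = - (y - x)" by (simp add: scaleR_2)
      have nz: "norm (?z - x) = norm (y - x)" unfolding z by (rule norm_minus_cancel)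
      have Lz: "L (?z - x) = - L (y - x)" unfolding z using bl by (simp add: linear_simps)
      have x: "(1 - 1/2) *\<^sub>R y + (1/2) *\<^sub>R ?z = x" by (simp add: scaleR_right_diff_distrib)
      have "H x \<le> (H y + H ?z) / 2"
        using convex_onD[OF conv, of "1/2" y ?z] unfolding x by (simp add: field_simps)
      moreover have "\<bar>S ?z - S x - L (?z - x)\<bar> \<le> e * norm (y - x)"
        using d(2)[of ?z] y unfolding nz by simp
      ultimately show ?thesis using d(2)[OF y] le[of y] le[of ?z] eq unfolding Lz
        by (simp add: abs_le_iff)
    qed
    with d(1) show "\<exists>d>0. \<forall>y. norm (y - x) < d \<longrightarrow> norm (H y - H x - L (y - x)) \<le> e * norm (y - x)"
      by auto
  qed
  then show ?thesis by (auto simp: differentiable_def)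
qed

section \<open>The envelope of a squared gauge\<close>

text \<open>A mere upper bound \<open>b\<close> suffices, which matters for convexity: there
  \<open>f\<close> is only estimated at the competitor.\<close>

lemma moreau_envelope_le:
  assumes "f y \<le> ereal b" "0 \<le> f y"
  shows "moreau_envelope r (\<lambda>y. (f y)\<^sup>2) x \<le> ereal (b\<^sup>2 + r / 2 * (norm (y - x))\<^sup>2)"
proof -
  obtain t where t: "f y = ereal t" "0 \<le> t" "t \<le> b" using assms by (cases "f y") auto
  have "moreau_envelope r (\<lambda>y. (f y)\<^sup>2) x \<le> (f y)\<^sup>2 + ereal (r / 2 * (norm (y - x))\<^sup>2)"
    unfolding moreau_envelope_def by (rule INF_lower) simp
  also have "\<dots> \<le> ereal (b\<^sup>2 + r / 2 * (norm (y - x))\<^sup>2)"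
    using t by (simp add: power_mono)
  finally show ?thesis .
qed

lemma moreau_envelope_attained:
  fixes f :: "'a::euclidean_space \<Rightarrow> ereal"
  assumes "gauge_function f" "lower_semicontinuous f" "r > 0"
  obtains p a where "f p = ereal a" "0 \<le> a"
    "moreau_envelope r (\<lambda>y. (f y)\<^sup>2) x = ereal (a\<^sup>2 + r / 2 * (norm (p - x))\<^sup>2)"
proof -
  have f: "0 \<le> f y" "f 0 = 0" for y using assms(1) by (auto simp: gauge_function_def)
  define \<phi> where "\<phi> y = (f y)\<^sup>2 + ereal (r / 2 * (norm (y - x))\<^sup>2)" for y
  have \<phi>0: "\<phi> 0 = ereal (r / 2 * (norm x)\<^sup>2)" by (simp add: \<phi>_def f power2_eq_square)
  have f2: "0 \<le> (f y)\<^sup>2" for y using f by (simp add: power2_eq_square)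
  have "lower_semicontinuous \<phi>"
    unfolding \<phi>_def using assms f
    by (intro lower_semicontinuous_add lower_semicontinuous_power2 lower_semicontinuous_continuous
        continuous_intros f2) auto
  \<comment> \<open>The origin lies on the boundary of this ball and \<open>f\<close> vanishes
    there, so every point outside costs at least \<open>\<phi> 0\<close> through its distance to
    \<open>x\<close> alone.\<close>
  moreover have "compact (cball x (norm x))" "cball x (norm x) \<noteq> {}" by auto
  ultimately obtain p where p: "p \<in> cball x (norm x)" "\<And>y. y \<in> cball x (norm x) \<Longrightarrow> \<phi> p \<le> \<phi> y"
    using lower_semicontinuous_attains_inf by metis
  have p0: "\<phi> p \<le> \<phi> 0" using p(2)[of 0] by simp
  have "\<phi> p \<le> \<phi> y" for y
  proof (cases "y \<in> cball x (norm x)")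
    case False
    then have "norm x \<le> norm (y - x)" by (simp add: dist_norm norm_minus_commute)
    then have "r / 2 * (norm x)\<^sup>2 \<le> r / 2 * (norm (y - x))\<^sup>2"
      using assms(3) by (simp add: power_mono)
    then have "\<phi> 0 \<le> 0 + ereal (r / 2 * (norm (y - x))\<^sup>2)" by (simp add: \<phi>0)
    also have "\<dots> \<le> \<phi> y" unfolding \<phi>_def by (intro add_right_mono f2)
    finally show ?thesis using p0 by simp
  qed (rule p(2))
  then have eq: "moreau_envelope r (\<lambda>y. (f y)\<^sup>2) x = \<phi> p"
    unfolding moreau_envelope_def \<phi>_def[symmetric] by (intro antisym INF_lower INF_greatest) auto
  \<comment> \<open>An infinite \<open>f p\<close> would make \<open>\<phi> p\<close> infinite,
    against the finite bound \<open>\<phi> 0\<close>.\<close>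
  obtain a where a: "f p = ereal a"
    using p0 f(1)[of p] unfolding \<phi>0 by (cases "f p") (auto simp: \<phi>_def power2_eq_square)
  show thesis
  proof
    show "f p = ereal a" "0 \<le> a" using a f(1)[of p] by auto
    show "moreau_envelope r (\<lambda>y. (f y)\<^sup>2) x = ereal (a\<^sup>2 + r / 2 * (norm (p - x))\<^sup>2)"
      unfolding eq \<phi>_def a by simp
  qed
qed

lemma ereal_sqrt_mono: "s \<le> t \<Longrightarrow> ereal_sqrt s \<le> ereal_sqrt t"
  by (cases s; cases t)
    (auto simp: ereal_sqrt.simps(2,3)[unfolded infinity_ereal_def[symmetric] MInfty_eq_minfinity])

text \<open>A real-valued form gives access to real convexity and calculus. For a lower
  semicontinuous gauge and \<open>r > 0\<close> nothing is lost, since the envelope is finite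
  everywhere.\<close>

definition sqrt_envelope :: "real \<Rightarrow> ('a::real_normed_vector \<Rightarrow> ereal) \<Rightarrow> 'a \<Rightarrow> real" where
  "sqrt_envelope r f x = real_of_ereal (ereal_sqrt (moreau_envelope r (\<lambda>y. (f y)\<^sup>2) x))"

context
  fixes f :: "'a::euclidean_space \<Rightarrow> ereal" and r :: real
  assumes gauge: "gauge_function f" and lsc: "lower_semicontinuous f" and r: "r > 0"
begin

lemma ereal_sqrt_envelope:
  "ereal_sqrt (moreau_envelope r (\<lambda>y. (f y)\<^sup>2) x) = ereal (sqrt_envelope r f x)"
  by (rule moreau_envelope_attained[OF gauge lsc r, of x]) (simp add: sqrt_envelope_def)

lemma sqrt_envelope_attained:
  obtains p a where "f p = ereal a" "0 \<le> a"
    "sqrt_envelope r f x = sqrt (a\<^sup>2 + (sqrt (r / 2) * norm (p - x))\<^sup>2)"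
proof -
  obtain p a where p: "f p = ereal a" "0 \<le> a"
    "moreau_envelope r (\<lambda>y. (f y)\<^sup>2) x = ereal (a\<^sup>2 + r / 2 * (norm (p - x))\<^sup>2)"
    by (rule moreau_envelope_attained[OF gauge lsc r])
  show thesis
    by (rule that[OF p(1,2)]) (use r in \<open>simp add: sqrt_envelope_def p(3) power_mult_distrib\<close>)
qed

lemma sqrt_envelope_le:
  assumes "f y \<le> ereal b"
  shows "sqrt_envelope r f x \<le> sqrt (b\<^sup>2 + (sqrt (r / 2) * norm (y - x))\<^sup>2)"
proof -
  have "0 \<le> f y" using gauge by (simp add: gauge_function_def)
  from ereal_sqrt_mono[OF moreau_envelope_le[of f, OF assms this, of r x]] show ?thesis
    using r by (simp add: ereal_sqrt_envelope power_mult_distrib)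
qed

lemma sqrt_envelope_nonneg: "0 \<le> sqrt_envelope r f x"
  by (rule sqrt_envelope_attained[of x]) simp

text \<open>Both coordinates vanish only if \<open>p = x\<close> and \<open>f p = 0\<close>, which
  forces \<open>f x = 0\<close>.\<close>

lemma sqrt_envelope_pos:
  assumes "f x \<noteq> 0"
  shows "0 < sqrt_envelope r f x"
proof -
  obtain p a where p: "f p = ereal a" "0 \<le> a"
    "sqrt_envelope r f x = sqrt (a\<^sup>2 + (sqrt (r / 2) * norm (p - x))\<^sup>2)"
    by (rule sqrt_envelope_attained)
  have "a \<noteq> 0 \<or> p \<noteq> x" using assms p(1) by (auto simp: zero_ereal_def)
  then show ?thesis using r by (simp add: p(3) sum_power2_gt_zero_iff)
qed

section \<open>The gauge properties of the root of the envelope\<close>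

lemma sqrt_envelope_zero: "sqrt_envelope r f 0 = 0"
  using sqrt_envelope_le[of 0 0 0] sqrt_envelope_nonneg[of 0] gauge
  by (simp add: gauge_function_def)

text \<open>The scaled minimizer \<open>c *\<^sub>R p\<close> competes at the scaled point, and both
  coordinates of the pair scale by \<open>c\<close>. Applied to \<open>inverse c\<close>, the
  inequality also yields its converse.\<close>

lemma sqrt_envelope_scaleR_le:
  assumes "c > 0"
  shows "sqrt_envelope r f (c *\<^sub>R x) \<le> c * sqrt_envelope r f x"
proof -
  obtain p a where p: "f p = ereal a" "0 \<le> a"
    "sqrt_envelope r f x = sqrt (a\<^sup>2 + (sqrt (r / 2) * norm (p - x))\<^sup>2)"
    by (rule sqrt_envelope_attained)
  have "f (c *\<^sub>R p) = ereal (c * a)" using gauge assms p(1) by (simp add: gauge_function_def)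
  then have "sqrt_envelope r f (c *\<^sub>R x)
      \<le> sqrt ((c * a)\<^sup>2 + (sqrt (r / 2) * norm (c *\<^sub>R p - c *\<^sub>R x))\<^sup>2)"
    by (intro sqrt_envelope_le) simp
  also have "norm (c *\<^sub>R p - c *\<^sub>R x) = c * norm (p - x)"
    using assms by (simp flip: scaleR_right_diff_distrib)
  also have "(c * a)\<^sup>2 + (sqrt (r / 2) * (c * norm (p - x)))\<^sup>2
      = c\<^sup>2 * (a\<^sup>2 + (sqrt (r / 2) * norm (p - x))\<^sup>2)"
    by (simp add: power_mult_distrib algebra_simps)
  also have "sqrt \<dots> = c * sqrt_envelope r f x"
    using assms by (simp add: p(3) real_sqrt_mult)
  finally show ?thesis .
qed

lemma sqrt_envelope_scaleR:
  assumes "c > 0"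
  shows "sqrt_envelope r f (c *\<^sub>R x) = c * sqrt_envelope r f x"
proof (rule antisym)
  show "sqrt_envelope r f (c *\<^sub>R x) \<le> c * sqrt_envelope r f x"
    by (rule sqrt_envelope_scaleR_le[OF assms])
  show "c * sqrt_envelope r f x \<le> sqrt_envelope r f (c *\<^sub>R x)"
    using sqrt_envelope_scaleR_le[of "inverse c" "c *\<^sub>R x"] assms by (simp add: field_simps)
qed

lemma sqrt_envelope_convex_combination:
  assumes "u \<ge> 0" "v \<ge> 0" "u + v = 1"
  shows "sqrt_envelope r f (u *\<^sub>R x + v *\<^sub>R y) \<le> u * sqrt_envelope r f x + v * sqrt_envelope r f y"
proof -
  let ?s = "sqrt (r / 2)"
  obtain p a where p: "f p = ereal a" "0 \<le> a"
    "sqrt_envelope r f x = sqrt (a\<^sup>2 + (?s * norm (p - x))\<^sup>2)"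
    by (rule sqrt_envelope_attained)
  obtain q b where q: "f q = ereal b" "0 \<le> b"
    "sqrt_envelope r f y = sqrt (b\<^sup>2 + (?s * norm (q - y))\<^sup>2)"
    by (rule sqrt_envelope_attained)
  \<comment> \<open>The same convex combination of the two minimizers serves as competitor.\<close>
  have "f (u *\<^sub>R p + v *\<^sub>R q) \<le> ereal u * f p + ereal v * f q"
    using gauge assms unfolding gauge_function_def ereal_convex_def by blast
  then have "f (u *\<^sub>R p + v *\<^sub>R q) \<le> ereal (u * a + v * b)" by (simp add: p q)
  then have "sqrt_envelope r f (u *\<^sub>R x + v *\<^sub>R y)
     \<le> sqrt ((u * a + v * b)\<^sup>2 + (?s * norm (u *\<^sub>R p + v *\<^sub>R q - (u *\<^sub>R x + v *\<^sub>R y)))\<^sup>2)"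
    by (rule sqrt_envelope_le)
  also have "\<dots> \<le> sqrt ((u * a + v * b)\<^sup>2 + (u * (?s * norm (p - x)) + v * (?s * norm (q - y)))\<^sup>2)"
  proof -
    have "norm (u *\<^sub>R p + v *\<^sub>R q - (u *\<^sub>R x + v *\<^sub>R y)) = norm (u *\<^sub>R (p - x) + v *\<^sub>R (q - y))"
      by (simp add: algebra_simps)
    also have "\<dots> \<le> u * norm (p - x) + v * norm (q - y)"
      using assms norm_triangle_ineq[of "u *\<^sub>R (p - x)" "v *\<^sub>R (q - y)"] by simp
    finally have "?s * norm (u *\<^sub>R p + v *\<^sub>R q - (u *\<^sub>R x + v *\<^sub>R y))
        \<le> ?s * (u * norm (p - x) + v * norm (q - y))"
      using r by (intro mult_left_mono) auto
    also have "\<dots> = u * (?s * norm (p - x)) + v * (?s * norm (q - y))"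
      by (simp only: distrib_left mult.left_commute)
    finally show ?thesis
      using r by (intro real_sqrt_le_mono add_left_mono power_mono) simp_all
  qed
  \<comment> \<open>Minkowski's inequality for the plane vectors \<open>u (a, ?s |p - x|)\<close>
    and \<open>v (b, ?s |q - y|)\<close>.\<close>
  also have "\<dots> \<le> sqrt ((u * a)\<^sup>2 + (u * (?s * norm (p - x)))\<^sup>2)
      + sqrt ((v * b)\<^sup>2 + (v * (?s * norm (q - y)))\<^sup>2)"
    by (rule real_sqrt_sum_squares_triangle_ineq)
  also have "\<dots> = u * sqrt_envelope r f x + v * sqrt_envelope r f y"
    using assms
    by (simp add: p(3) q(3) power_mult_distrib[of u] power_mult_distrib[of v] real_sqrt_mult
        flip: distrib_left)
  finally show ?thesis .
qed

lemma gauge_function_sqrt_envelope: "gauge_function (\<lambda>x. ereal (sqrt_envelope r f x))"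
  unfolding gauge_function_def ereal_convex_def
  using sqrt_envelope_nonneg sqrt_envelope_zero sqrt_envelope_scaleR sqrt_envelope_convex_combination
  by simp

section \<open>Differentiability off the zero set\<close>

lemma differentiable_sqrt_envelope:
  assumes "f x \<noteq> 0"
  shows "sqrt_envelope r f differentiable (at x)"
proof -
  obtain p a where p: "f p = ereal a" "0 \<le> a"
    "sqrt_envelope r f x = sqrt (a\<^sup>2 + (sqrt (r / 2) * norm (p - x))\<^sup>2)"
    by (rule sqrt_envelope_attained)
  \<comment> \<open>With the squared norm as an inner product, the derivative rules apply without
    knowing that \<open>p\<close> differs from \<open>x\<close>; only the root needs a positive
    argument.\<close>
  define S where "S y = sqrt (a\<^sup>2 + r / 2 * ((p - y) \<bullet> (p - y)))" for y
  have S: "S y = sqrt (a\<^sup>2 + (sqrt (r / 2) * norm (p - y))\<^sup>2)" for y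
    using r by (simp add: S_def power_mult_distrib power2_norm_eq_inner)
  have pos: "0 < a\<^sup>2 + r / 2 * ((p - x) \<bullet> (p - x))"
    using sqrt_envelope_pos[OF assms] unfolding p(3) S[symmetric] S_def by simp
  show ?thesis
  proof (rule differentiable_if_convex_touching_majorant)
    show "convex_on UNIV (sqrt_envelope r f)"
      by (intro convex_onI sqrt_envelope_convex_combination) auto
    show "S differentiable (at x)"
      unfolding S_def[abs_def] differentiable_def
      by (rule exI, (rule derivative_eq_intros refl pos)+)
    show "sqrt_envelope r f y \<le> S y" for y unfolding S by (rule sqrt_envelope_le) (simp add: p)
    show "sqrt_envelope r f x = S x" by (simp add: S p(3))
  qed
qed

section \<open>Two-sided bounds and the limit for large r\<close>

lemma sqrt_envelope_le_self: "ereal (sqrt_envelope r f x) \<le> f x"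
proof (cases "f x")
  case (real t)
  with gauge have "0 \<le> t" by (metis ereal_less_eq(5) gauge_function_def)
  with real show ?thesis using sqrt_envelope_le[of x t x] by simp
qed (use gauge in \<open>auto simp: gauge_function_def dest: spec[of _ x]\<close>)

text \<open>A minimizer within \<open>\<delta>\<close> of \<open>x\<close> pays at least
  \<open>a\<close> in its first coordinate, one farther away at least
  \<open>sqrt (r / 2) * \<delta>\<close> in its second.\<close>

lemma sqrt_envelope_ge:
  assumes "0 \<le> a" "\<And>y. dist y x < \<delta> \<Longrightarrow> ereal a < f y" "a \<le> sqrt (r / 2) * \<delta>"
  shows "a \<le> sqrt_envelope r f x"
proof -
  obtain p b where p: "f p = ereal b" "0 \<le> b"
    "sqrt_envelope r f x = sqrt (b\<^sup>2 + (sqrt (r / 2) * norm (p - x))\<^sup>2)"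
    by (rule sqrt_envelope_attained)
  show ?thesis
  proof (cases "dist p x < \<delta>")
    case True
    then have "a \<le> b" using assms(2)[of p] p by simp
    also have "\<dots> \<le> sqrt_envelope r f x" unfolding p(3) by (rule real_sqrt_sum_squares_ge1)
    finally show ?thesis .
  next
    case False
    note assms(3)
    also have "sqrt (r / 2) * \<delta> \<le> sqrt (r / 2) * norm (p - x)"
      using False r by (intro mult_left_mono) (auto simp: dist_norm)
    also have "\<dots> \<le> sqrt_envelope r f x" unfolding p(3) by (rule real_sqrt_sum_squares_ge2)
    finally show ?thesis .
  qed
qed

end

lemma sqrt_envelope_tendsto:
  fixes f :: "'a::euclidean_space \<Rightarrow> ereal"
  assumes "gauge_function f" "lower_semicontinuous f"
  shows "((\<lambda>r. ereal (sqrt_envelope r f x)) \<longlongrightarrow> f x) at_top"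
proof (rule order_tendstoI)
  fix c assume "f x < c"
  then show "\<forall>\<^sub>F r in at_top. ereal (sqrt_envelope r f x) < c"
    using sqrt_envelope_le_self[OF assms]
    by (intro eventually_mono[OF eventually_gt_at_top[of 0]]) (meson le_less_trans)
next
  fix c assume c: "c < f x"
  show "\<forall>\<^sub>F r in at_top. c < ereal (sqrt_envelope r f x)"
  proof (cases "0 \<le> c")
    case False
    then show ?thesis using sqrt_envelope_nonneg[OF assms]
      by (intro eventually_mono[OF eventually_gt_at_top[of 0]])
        (metis ereal_less_eq(5) less_le_trans not_le)
  next
    case True
    \<comment> \<open>A real level strictly below \<open>f x\<close> treats finite and infinite
      \<open>f x\<close> alike.\<close>
    from c obtain a where a: "c < ereal a" "ereal a < f x" by (meson ereal_dense2)
    then have "0 \<le> a" using True by (metis ereal_less_eq(5) less_imp_le order_trans)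
    from a(2) assms(2) obtain \<delta> where \<delta>: "\<delta> > 0" "\<And>y. dist y x < \<delta> \<Longrightarrow> ereal a < f y"
      unfolding lower_semicontinuous_iff eventually_nhds_metric by blast
    have "\<forall>\<^sub>F r in at_top. a \<le> sqrt (r / 2) * \<delta>"
      \<comment> \<open>The threshold solves \<open>sqrt (r / 2) = a / \<delta>\<close> for
        \<open>r\<close>.\<close>
      using eventually_ge_at_top[of "2 * (a / \<delta>)\<^sup>2"]
    proof eventually_elim
      case (elim r)
      then have "a / \<delta> \<le> sqrt (r / 2)" by (intro real_le_rsqrt) simp
      with \<delta>(1) show ?case by (simp add: field_simps)
    qed
    then show ?thesis using eventually_gt_at_top[of 0]
    proof eventually_elim
      case (elim r)
      then have "a \<le> sqrt_envelope r f x"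
        using sqrt_envelope_ge[OF assms] \<delta>(2) \<open>0 \<le> a\<close> by blast
      with a(1) show ?case by (meson ereal_less_eq(3) less_le_trans)
    qed
  qed
qed

theorem theorem5p6:
  fixes f :: "real ^ 'n \<Rightarrow> ereal"
    and g h :: "real \<Rightarrow> real ^ 'n \<Rightarrow> ereal"
  assumes "gauge_function f"
    and "lower_semicontinuous f"
    and "\<And>r x. r > 0 \<Longrightarrow> g r x = moreau_envelope r (\<lambda>y. (f y)\<^sup>2) x"
    and "\<And>r x. r > 0 \<Longrightarrow> h r x = ereal_sqrt (g r x)"
  shows "(\<forall>r>0. gauge_function (h r) \<and>
            (\<forall>x. x \<notin> {x. f x = 0} \<longrightarrow> ereal_differentiable_at (h r) x)) \<and>
         (\<forall>x. ((\<lambda>r. h r x) \<longlongrightarrow> f x) at_top)"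
proof -
  have h: "h r = (\<lambda>x. ereal (sqrt_envelope r f x))" if "r > 0" for r
    using assms(3,4) ereal_sqrt_envelope[OF assms(1,2)] that by auto
  have "((\<lambda>r. h r x) \<longlongrightarrow> f x) at_top" for x
    \<comment> \<open>\<open>h\<close> is prescribed only for positive \<open>r\<close>, so the
      limit is transferred along eventual equality.\<close>
    by (rule Lim_transform_eventually[OF sqrt_envelope_tendsto[OF assms(1,2), of x]
          eventually_mono[OF eventually_gt_at_top[of 0]]]) (simp add: h)
  then show ?thesis
    using gauge_function_sqrt_envelope[OF assms(1,2)] differentiable_sqrt_envelope[OF assms(1,2)]
    by (auto simp: h ereal_differentiable_at_def)
qed

end
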